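(* Let $s>1$. (i) Let $T:[r_0,\infty)\to[1,\infty)$ be a continuous increasing function. Then $$T\Bigl(r+\frac{1}{T(r)}\Bigr)<\bigl(T(r)^{1/s}+1\bigr)^s$$ holds for all $r\ge r_0$ outside a possible exceptional set of linear measure at most $\zeta(s)$. (ii) Let $f$ be a meromorphic function in $\mathbf{C}$ of infinite order with Nevanlinna characteristic $T(r,f)$, and let $r_0>0$ be such that $T(r_0,f)\ge 1$. With $R=r+\frac{1}{T(r,f)}$, one has $$\log^+\Bigl(\frac{T(R,f)}{R-r}\,\frac{R}{r}\Bigr)\le 2\log^+T(r,f)+\log\Bigl[\Bigl(1+\frac{1}{T(r,f)^{1/s}}\Bigr)^s\Bigr]+\log\Bigl(1+\frac{1}{r\,T(r,f)}\Bigr)$$ for all $r\ge r_0$ outside a possible exceptional set of linear measure at most $\zeta(s)$.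
   Context: Linear measure means Lebesgue measure on the real line. $\zeta(s)=\sum_{n=1}^\infty n^{-s}$ for $s>1$ is the Riemann zeta-function. $\log^+x=\max\{\log x,0\}$ for $x>0$, and $\log^+0=0$. For a meromorphic function $f$ in $\mathbf{C}$, let $n(t,f;\infty)$ be the number of poles of $f$, counted with multiplicity, in $|z|\le t$, and set $$m(r,f;\infty)=\frac{1}{2\pi}\int_0^{2\pi}\log^+|f(re^{i\theta})|\,d\theta,$$ $$N(r,f;\infty)=\int_0^r\frac{n(t,f;\infty)-n(0,f;\infty)}{t}\,dt+n(0,f;\infty)\log r.$$ The Nevanlinna characteristic is $T(r,f)=m(r,f;\infty)+N(r,f;\infty)$; it is a continuous increasing function of $r$. The order of $f$ is $\rho(f)=\limsup_{r\to\infty}\frac{\log T(r,f)}{\log r}$, and $f$ has infinite order if $\rho(f)=\infty$. *)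

theory Defs
  imports "HOL-Complex_Analysis.Complex_Analysis"
begin

definition zeta_real :: "real \<Rightarrow> real" where
  "zeta_real s = (\<Sum>n. real (Suc n) powr (- s))"

definition log_plus :: "real \<Rightarrow> real" where
  "log_plus x = (if x > 0 then max (ln x) 0 else 0)"

(* The multiplicity of a pole z is - zorder f z; a function meromorphic in the plane has only
   finitely many poles in a disc, so the sum is a genuine finite sum. *)
definition pole_count :: "real \<Rightarrow> (complex \<Rightarrow> complex) \<Rightarrow> nat" where
  "pole_count t f = (\<Sum>z | cmod z \<le> t \<and> is_pole f z. nat (- zorder f z))"

(* f may take arbitrary values at its poles (and on any other discrete set); this affects the
   integrand only on a null set. *)
definition proximity :: "real \<Rightarrow> (complex \<Rightarrow> complex) \<Rightarrow> real" where
  "proximity r f =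
     1 / (2 * pi) * (LINT \<theta>:{0..2 * pi}|lborel. log_plus (cmod (f (of_real r * cis \<theta>))))"

definition pole_counting :: "real \<Rightarrow> (complex \<Rightarrow> complex) \<Rightarrow> real" where
  "pole_counting r f =
     (LINT t:{0..r}|lborel. (real (pole_count t f) - real (pole_count 0 f)) / t)
     + real (pole_count 0 f) * ln r"

definition nevanlinna_char :: "real \<Rightarrow> (complex \<Rightarrow> complex) \<Rightarrow> real" where
  "nevanlinna_char r f = proximity r f + pole_counting r f"

(* For non-constant f, nevanlinna_char r f is positive for all large r, so the convention
   ln 0 = 0 can matter only for constant functions, whose order is not infinite anyway. *)
definition growth_order :: "(complex \<Rightarrow> complex) \<Rightarrow> ereal" where
  "growth_order f = Limsup at_top (\<lambda>r. ereal (ln (nevanlinna_char r f) / ln r))"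

(* P r holds for all r \<ge> r0 outside an exceptional set of linear measure at most c. *)
definition holds_outside_measure :: "real \<Rightarrow> real \<Rightarrow> (real \<Rightarrow> bool) \<Rightarrow> bool" where
  "holds_outside_measure r0 c P \<longleftrightarrow>
     (\<exists>E \<in> sets lebesgue. emeasure lebesgue E \<le> ennreal c \<and> (\<forall>r \<ge> r0. r \<notin> E \<longrightarrow> P r))"

end

theory Submission
  imports Defs
begin

text \<open>
  Both parts rest on one growth estimate for a nondecreasing function \<open>T \<ge> 1\<close>. Where the inequality of
  part (i) fails, \<open>g = T powr (1/s)\<close> rises by at least \<open>1\<close> within distance \<open>1/T r = g r powr -s\<close>. The
  failures with \<open>n \<le> g r < n + 1\<close> can therefore not be spread further than \<open>n powr -s\<close>: after any of
  them, \<open>g\<close> reaches \<open>n + 1\<close> within that distance. Covering level \<open>n\<close> by an interval of length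
  \<open>n powr -s\<close> gives total measure \<open>\<zeta>(s)\<close> (lemma \<open>growth_outside_small_set\<close>).

  Part (ii) is this estimate for \<open>T r = T(r, f)\<close>, followed by a rearrangement of logarithms (lemma
  \<open>nevanlinna_growth\<close>). It remains to see that the characteristic is nondecreasing (lemma
  \<open>nevanlinna_char_mono\<close>). In a disc of radius \<open>R\<close> write \<open>f = h / P\<close> with \<open>P\<close> the monic polynomial that
  vanishes at the poles with their multiplicities, so that \<open>log\<^sup>+ \<bar>f\<bar> = ln (max \<bar>h\<bar> \<bar>P\<bar>) - ln \<bar>P\<bar>\<close>. By Jensen's formula for linear
  factors the circle mean of \<open>ln \<bar>P\<bar>\<close> equals the counting function up to an additive constant, and
  hence \<open>T(r, f)\<close> is, up to that constant, the mean over \<open>\<bar>z\<bar> = r\<close> of the subharmonic function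
  \<open>ln (max \<bar>h\<bar> \<bar>P\<bar>)\<close>. Such means increase with \<open>r\<close> (lemma \<open>circle_mean_ln_max_norm_mono\<close>): on the outer
  circle the function is bounded above, up to \<open>\<epsilon>\<close>, by the real part of a polynomial \<open>p\<close>
  (Stone--Weierstrass); the maximum modulus principle for \<open>h * exp (- p)\<close> and \<open>P * exp (- p)\<close> carries
  the bound into the disc; and \<open>Re p\<close> has the same mean over all circles.
\<close>

section \<open>Growth of monotone functions outside a set of small measure\<close>

lemma summable_zeta_real:
  fixes s :: real
  assumes "s > 1"
  shows "summable (\<lambda>n. real (Suc n) powr (- s))"
  using assms summable_real_powr_iff[of "-s"] summable_Suc_iff[of "\<lambda>n. real n powr (- s)"]
  by simp

text \<open>
  With \<open>g = T powr (1/s)\<close> the inequality fails at \<open>r\<close> exactly when \<open>g\<close> gains at least \<open>1\<close> on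
  \<open>[r, r + 1/T r]\<close>. Sort the failures by the integer part \<open>n\<close> of \<open>g r\<close>. If \<open>r < r'\<close> both fail on
  level \<open>n\<close>, then \<open>g (r + 1/T r) \<ge> n + 1 > g r'\<close>, so by monotonicity \<open>r'\<close> lies before
  \<open>r + 1/T r \<le> r + n powr -s\<close>. A level therefore fits into an interval of length \<open>n powr -s\<close>, and
  these lengths add up to \<open>\<zeta>(s)\<close>.
\<close>
lemma growth_outside_small_set:
  fixes s r0 :: real and T :: "real \<Rightarrow> real"
  assumes s: "s > 1"
    and mono: "mono_on {r0..} T"
    and ge1: "\<And>r. r \<ge> r0 \<Longrightarrow> T r \<ge> 1"
  shows "holds_outside_measure r0 (zeta_real s)
           (\<lambda>r. T (r + 1 / T r) < (T r powr (1 / s) + 1) powr s)"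
proof -
  define g where "g r = T r powr (1 / s)" for r
  have g_powr: "g r powr s = T r" if "r \<ge> r0" for r
    using ge1[OF that] s by (simp add: g_def powr_powr)
  have g_ge1: "g r \<ge> 1" if "r \<ge> r0" for r
    using ge1[OF that] s by (simp add: g_def ge_one_powr_ge_zero)
  have g_mono: "g r \<le> g r'" if "r0 \<le> r" "r \<le> r'" for r r'
    unfolding g_def using that ge1[of r] s by (intro powr_mono2 mono_onD[OF mono]) auto
  define E where
    "E n = {r \<in> {r0..}. g r + 1 \<le> g (r + 1 / T r) \<and> real (Suc n) \<le> g r \<and> g r < real (Suc n) + 1}" for n
  define J where
    "J n = (if E n = {} then {} else {Inf (E n)..Inf (E n) + real (Suc n) powr (- s)})" for n
  \<comment> \<open>\<open>E n\<close> collects the failures with \<open>g r\<close> in \<open>[n + 1, n + 2)\<close>; the index is shifted because \<open>g \<ge> 1\<close>.\<close>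
  have diam: "r' \<le> r + real (Suc n) powr (- s)" if "r \<in> E n" "r' \<in> E n" for r r' n
  proof -
    have r: "r0 \<le> r" "r0 \<le> r'" using that by (auto simp: E_def)
    have "g r' < g (r + 1 / T r)" using that by (auto simp: E_def)
    moreover have "r0 \<le> r + 1 / T r" using r(1) ge1[OF r(1)] by (simp add: add_increasing2)
    ultimately have "r' < r + 1 / T r"
      using g_mono[of "r + 1 / T r" r'] by (cases "r + 1 / T r \<le> r'") auto
    moreover have "real (Suc n) powr s \<le> T r"
      using that g_powr[OF r(1)] powr_mono2[of s "real (Suc n)" "g r"] s by (auto simp: E_def)
    then have "1 / T r \<le> real (Suc n) powr (- s)"
      using ge1[OF r(1)] by (simp add: powr_minus divide_simps)
    ultimately show ?thesis by simp
  qed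
  have E_J: "E n \<subseteq> J n" for n
  proof
    fix r assume r: "r \<in> E n"
    have bdd: "bdd_below (E n)" by (rule bdd_belowI[of _ r0]) (auto simp: E_def)
    have "r - real (Suc n) powr (- s) \<le> Inf (E n)"
      using r diam[of _ n r] by (intro cInf_greatest) (auto simp: algebra_simps)
    moreover have "Inf (E n) \<le> r" using r bdd by (rule cInf_lower)
    ultimately show "r \<in> J n" using r by (auto simp: J_def)
  qed
  have J_meas: "J n \<in> sets lebesgue" for n by (auto simp: J_def)
  have J_small: "emeasure lebesgue (J n) \<le> ennreal (real (Suc n) powr (- s))" for n
    by (auto simp: J_def)
  have "emeasure lebesgue (\<Union>n. J n) \<le> (\<Sum>n. emeasure lebesgue (J n))"
    using J_meas by (intro emeasure_subadditive_countably) auto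
  also have "\<dots> \<le> (\<Sum>n. ennreal (real (Suc n) powr (- s)))"
    by (intro suminf_le J_small) auto
  also have "\<dots> = ennreal (zeta_real s)"
    unfolding zeta_real_def by (intro suminf_ennreal2 summable_zeta_real s) auto
  finally have small: "emeasure lebesgue (\<Union>n. J n) \<le> ennreal (zeta_real s)" .
  have "T (r + 1 / T r) < (T r powr (1 / s) + 1) powr s" if r: "r \<ge> r0" "r \<notin> (\<Union>n. J n)" for r
  proof (rule ccontr)
    assume "\<not> ?thesis"
    then have le: "(g r + 1) powr s \<le> T (r + 1 / T r)" by (simp add: g_def)
    have "((g r + 1) powr s) powr (1 / s) \<le> g (r + 1 / T r)"
      unfolding g_def[of "r + 1 / T r"] using s by (intro powr_mono2 le) auto
    then have step: "g r + 1 \<le> g (r + 1 / T r)"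
      using s g_ge1[OF r(1)] by (simp add: powr_powr)
    define n where "n = nat \<lfloor>g r\<rfloor> - 1"
    have "real (Suc n) = of_int \<lfloor>g r\<rfloor>"
      using g_ge1[OF r(1)] unfolding n_def by simp
    then have "r \<in> E n"
      using step r(1) unfolding E_def by simp
    then show False using E_J r(2) by blast
  qed
  with small J_meas show ?thesis
    unfolding holds_outside_measure_def by (intro bexI[of _ "\<Union>n. J n"]) auto
qed

text \<open>
  Since \<open>R - r = 1 / T r\<close>, the argument of the logarithm on the left is
  \<open>T R * T r * (1 + 1/(r T r))\<close>; the growth bound
  \<open>T R < (T r powr (1/s) + 1) powr s = T r * (1 + 1/T r powr (1/s)) powr s\<close> replaces \<open>T R\<close> by a
  second factor \<open>T r\<close> at the cost of the middle term on the right.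
\<close>
lemma nevanlinna_growth:
  fixes s r0 :: real and T :: "real \<Rightarrow> real"
  assumes s: "s > 1" and "r0 > 0"
    and mono: "mono_on {r0..} T" and ge1: "T r0 \<ge> 1"
  shows "holds_outside_measure r0 (zeta_real s)
              (\<lambda>r. let R = r + 1 / T r in
                 log_plus (T R / (R - r) * (R / r))
                 \<le> 2 * log_plus (T r)
                   + ln ((1 + 1 / T r powr (1 / s)) powr s)
                   + ln (1 + 1 / (r * T r)))"
proof -
  have T1: "T r \<ge> 1" if "r \<ge> r0" for r
    using mono_onD[OF mono, of r0 r] that ge1 by simp
  have key: "let R = r + 1 / T r in
                 log_plus (T R / (R - r) * (R / r))
                 \<le> 2 * log_plus (T r)
                   + ln ((1 + 1 / T r powr (1 / s)) powr s)
                   + ln (1 + 1 / (r * T r))"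
    if r: "r \<ge> r0" and less: "T (r + 1 / T r) < (T r powr (1 / s) + 1) powr s" for r
  proof -
    define R where "R = r + 1 / T r"
    have r_pos: "r > 0" and Tr: "T r \<ge> 1" using r \<open>r0 > 0\<close> T1 by auto
    have "R \<ge> r0" using r Tr by (simp add: R_def add_increasing2)
    then have TR: "T R \<ge> 1" by (rule T1)
    have R_eq: "T R / (R - r) * (R / r) = T R * T r * (1 + 1 / (r * T r))"
      using r_pos Tr by (simp add: R_def field_simps)
    have "1 \<le> T R * T r" using mult_mono[of 1 "T R" 1 "T r"] TR Tr by simp
    moreover have "1 \<le> 1 + 1 / (r * T r)" using r_pos Tr by simp
    ultimately have "1 \<le> T R * T r * (1 + 1 / (r * T r))"
      using mult_mono[of 1 "T R * T r" 1 "1 + 1 / (r * T r)"] by simp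
    then have "log_plus (T R / (R - r) * (R / r)) = ln (T R * T r * (1 + 1 / (r * T r)))"
      unfolding R_eq log_plus_def by simp
    also have "\<dots> = ln (T R) + ln (T r) + ln (1 + 1 / (r * T r))"
    proof -
      have "0 < 1 + 1 / (r * T r)" using \<open>1 \<le> 1 + 1 / (r * T r)\<close> by linarith
      then show ?thesis using TR Tr by (simp add: ln_mult)
    qed
    also have "ln (T R) \<le> ln (T r * (1 + 1 / T r powr (1 / s)) powr s)"
    proof -
      have "T r * (1 + 1 / T r powr (1 / s)) powr s
            = (T r powr (1 / s)) powr s * (1 + 1 / T r powr (1 / s)) powr s"
        using Tr s by (simp add: powr_powr)
      also have "\<dots> = (T r powr (1 / s) * (1 + 1 / T r powr (1 / s))) powr s"
        using Tr by (simp add: powr_mult)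
      also have "T r powr (1 / s) * (1 + 1 / T r powr (1 / s)) = T r powr (1 / s) + 1"
        using Tr by (simp add: field_simps)
      finally have eq: "T r * (1 + 1 / T r powr (1 / s)) powr s = (T r powr (1 / s) + 1) powr s" .
      show ?thesis unfolding eq using less TR by (intro ln_mono) (auto simp: R_def)
    qed
    also have "\<dots> = ln (T r) + ln ((1 + 1 / T r powr (1 / s)) powr s)"
    proof (rule ln_mult_pos)
      have "0 < 1 + 1 / T r powr (1 / s)" using Tr by (simp add: add_pos_nonneg)
      then show "0 < (1 + 1 / T r powr (1 / s)) powr s" by simp
    qed (use Tr in simp)
    finally have "log_plus (T R / (R - r) * (R / r))
        \<le> 2 * log_plus (T r) + ln ((1 + 1 / T r powr (1 / s)) powr s) + ln (1 + 1 / (r * T r))"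
      using Tr unfolding log_plus_def[of "T r"] by simp
    then show ?thesis unfolding R_def Let_def .
  qed
  show ?thesis
    using growth_outside_small_set[OF s mono T1] key
    unfolding holds_outside_measure_def by blast
qed

section \<open>Means over circles\<close>

definition circle_mean :: "(complex \<Rightarrow> real) \<Rightarrow> real \<Rightarrow> real" where
  "circle_mean u r = 1 / (2 * pi) * (LINT \<theta>:{0..2 * pi}|lborel. u (of_real r * cis \<theta>))"

definition circle_integrable :: "(complex \<Rightarrow> real) \<Rightarrow> real \<Rightarrow> bool" where
  "circle_integrable u r = set_integrable lborel {0..2 * pi} (\<lambda>\<theta>. u (of_real r * cis \<theta>))"

lemma circle_param_in_sphere: "r \<ge> 0 \<Longrightarrow> of_real r * cis \<theta> \<in> sphere 0 r"
  by (simp add: norm_mult)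

lemma continuous_imp_circle_integrable:
  assumes "continuous_on (sphere 0 r) u" "r \<ge> 0"
  shows "circle_integrable u r"
  unfolding circle_integrable_def set_integrable_def
proof (rule borel_integrable_compact)
  show "continuous_on {0..2 * pi} (\<lambda>\<theta>. u (of_real r * cis \<theta>))"
    by (rule continuous_on_compose2[OF assms(1)])
       (auto intro!: continuous_intros simp: norm_mult assms)
qed simp

lemma circle_mean_mono:
  assumes "circle_integrable u r" "circle_integrable v r" "r \<ge> 0"
    and "\<And>z. z \<in> sphere 0 r \<Longrightarrow> u z \<le> v z"
  shows "circle_mean u r \<le> circle_mean v r"
  unfolding circle_mean_def
  using assms circle_param_in_sphere[OF assms(3)]
  by (intro mult_left_mono set_integral_mono) (auto simp: circle_integrable_def)

lemma circle_mean_add: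
  assumes "circle_integrable u r" "circle_integrable v r"
  shows "circle_mean (\<lambda>z. u z + v z) r = circle_mean u r + circle_mean v r"
  using assms unfolding circle_mean_def circle_integrable_def
  by (simp add: set_integral_add(2) ring_distribs)

lemma circle_integrable_add:
  "circle_integrable u r \<Longrightarrow> circle_integrable v r \<Longrightarrow> circle_integrable (\<lambda>z. u z + v z) r"
  unfolding circle_integrable_def by (rule set_integral_add)

lemma circle_integrable_const [simp]: "circle_integrable (\<lambda>z. c) r"
  unfolding circle_integrable_def set_integrable_def
  by (rule borel_integrable_compact) auto

lemma circle_mean_const [simp]: "circle_mean (\<lambda>z. c) r = c"
  by (simp add: circle_mean_def set_lebesgue_integral_def)

lemma holomorphic_mean_value:
  assumes "g holomorphic_on cball 0 r" "r > 0"
  shows "circle_mean (\<lambda>z. Re (g z)) r = Re (g 0)"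
proof -
  have "((\<lambda>u. g u / (u - 0)) has_contour_integral 2 * of_real pi * \<i> * g 0) (circlepath 0 r)"
    by (rule Cauchy_integral_circlepath_simple[OF assms(1)]) (use assms in auto)
  then have "((\<lambda>t. \<i> * g (of_real r * cis t)) has_integral 2 * of_real pi * \<i> * g 0) {0..2 * pi}"
    using assms(2) by (simp add: circlepath_def has_contour_integral_part_circlepath_iff field_simps)
  then have "((\<lambda>t. Re (-\<i> * (\<i> * g (of_real r * cis t)))) has_integral Re (-\<i> * (2 * of_real pi * \<i> * g 0))) {0..2 * pi}"
    by (intro has_integral_Re has_integral_mult_right)
  then have I: "((\<lambda>t. Re (g (of_real r * cis t))) has_integral 2 * pi * Re (g 0)) {0..2 * pi}"
    by simp
  have "continuous_on (sphere 0 r) (\<lambda>z. Re (g z))"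
    using assms by (intro continuous_intros holomorphic_on_imp_continuous_on holomorphic_on_subset[OF assms(1)]) auto
  then have "circle_integrable (\<lambda>z. Re (g z)) r"
    using assms by (intro continuous_imp_circle_integrable) auto
  then show ?thesis
    using integral_unique[OF I]
    by (simp add: circle_integrable_def circle_mean_def set_borel_integral_eq_integral)
qed

lemma circle_mean_diff:
  assumes "circle_integrable u r" "circle_integrable v r"
  shows "circle_mean (\<lambda>z. u z - v z) r = circle_mean u r - circle_mean v r"
  using assms unfolding circle_mean_def circle_integrable_def
  by (simp add: set_integral_diff(2) right_diff_distrib)

lemma circle_mean_weighted_sum:
  assumes "finite B" "\<And>b. b \<in> B \<Longrightarrow> circle_integrable (u b) r"
  shows "circle_integrable (\<lambda>z. \<Sum>b\<in>B. c b * u b z) r"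
    and "circle_mean (\<lambda>z. \<Sum>b\<in>B. c b * u b z) r = (\<Sum>b\<in>B. c b * circle_mean (u b) r)"
proof -
  have *: "circle_integrable (\<lambda>z. \<Sum>b\<in>B. c b * u b z) r \<and>
     circle_mean (\<lambda>z. \<Sum>b\<in>B. c b * u b z) r = (\<Sum>b\<in>B. c b * circle_mean (u b) r)"
    using assms
  proof induction
    case empty
    show ?case by (simp add: circle_integrable_def set_integrable_def)
  next
    case (insert b B)
    have b: "circle_integrable (\<lambda>z. c b * u b z) r"
      using insert.prems unfolding circle_integrable_def by (auto intro: set_integrable_mult_right)
    have B: "circle_integrable (\<lambda>z. \<Sum>b\<in>B. c b * u b z) r"
      "circle_mean (\<lambda>z. \<Sum>b\<in>B. c b * u b z) r = (\<Sum>b\<in>B. c b * circle_mean (u b) r)"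
      using insert by auto
    have "circle_mean (\<lambda>z. c b * u b z) r = c b * circle_mean (u b) r"
      by (simp add: circle_mean_def)
    then show ?case
      using insert.hyps circle_mean_add[OF b B(1)] B(2) b B(1)
      by (auto simp: circle_integrable_def intro: set_integral_add)
  qed
  show "circle_integrable (\<lambda>z. \<Sum>b\<in>B. c b * u b z) r" using * ..
  show "circle_mean (\<lambda>z. \<Sum>b\<in>B. c b * u b z) r = (\<Sum>b\<in>B. c b * circle_mean (u b) r)" using * ..
qed

lemma countable_circle_preimage:
  assumes "countable B" "r \<noteq> 0"
  shows "countable {\<theta>. of_real r * cis \<theta> \<in> B}"
proof -
  have "countable {\<theta>. of_real r * cis \<theta> = b}" for b
  proof (cases "\<exists>\<theta>. of_real r * cis \<theta> = b")
    case True
    then obtain \<theta>0 where \<theta>0: "b = of_real r * cis \<theta>0" by blast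
    have "{\<theta>. of_real r * cis \<theta> = b} \<subseteq> range (\<lambda>n::int. \<theta>0 + 2 * pi * n)"
      using assms(2) sin_cos_eq_iff[of _ \<theta>0] by (fastforce simp: \<theta>0 complex_eq_iff)
    then show ?thesis by (rule countable_subset) auto
  qed auto
  then have "countable (\<Union>b\<in>B. {\<theta>. of_real r * cis \<theta> = b})"
    using assms(1) by blast
  then show ?thesis by (rule countable_subset[rotated]) auto
qed

text \<open>
  This is how the arbitrary values of a meromorphic function at its singular points, which are only finitely
  many on each circle, drop out of its circle means.
\<close>
lemma circle_mean_cong_countable:
  assumes "countable B" "r > 0" "\<And>z. z \<in> sphere 0 r - B \<Longrightarrow> u z = v z"
  shows "circle_mean u r = circle_mean v r"
proof -
  have "(LINT \<theta>:{0..2 * pi}|lborel. u (of_real r * cis \<theta>)) = (LINT \<theta>:{0..2 * pi}|lborel. v (of_real r * cis \<theta>))"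
    unfolding set_lebesgue_integral_def
    by (rule integral_discrete_difference[where X = "{\<theta>. of_real r * cis \<theta> \<in> B}"])
       (use assms countable_circle_preimage circle_param_in_sphere[of r] in auto)
  then show ?thesis by (simp add: circle_mean_def)
qed

section \<open>Subharmonicity of the logarithm of a maximum of moduli\<close>

text \<open>
  On a circle of radius \<open>r\<close> one has \<open>z * cnj z = r\<^sup>2\<close>, so mixed monomials \<open>z ^ k * cnj (z ^ l)\<close> collapse
  to powers of \<open>z\<close> or of \<open>cnj z\<close>, and the real part does not distinguish \<open>w\<close> from \<open>cnj w\<close>. Together
  with \<open>2 * Re a * Re b = Re (a * b) + Re (a * cnj b)\<close> this makes the restrictions to the circle of the
  functions \<open>Re p\<close>, \<open>p\<close> a polynomial, closed under multiplication.
\<close>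
lemma Re_poly_mult_cnj_on_circle:
  "\<exists>p. \<forall>z \<in> sphere 0 r. Re (poly p1 z * cnj (poly p2 z)) = Re (poly p z)"
proof (induction p1 arbitrary: p2)
  case 0
  show ?case by (rule exI[of _ 0]) simp
next
  case (pCons a p1)
  obtain b q where p2: "p2 = pCons b q" by (cases p2)
  obtain p where p: "\<And>z. z \<in> sphere 0 r \<Longrightarrow> Re (poly p1 z * cnj (poly q z)) = Re (poly p z)"
    using pCons.IH by blast
  define p' where "p' = [:a * cnj b:] + smult (cnj a) (pCons 0 q) + smult (cnj b) (pCons 0 p1)
    + smult (of_real (r\<^sup>2)) p"
  have "Re (poly (pCons a p1) z * cnj (poly p2 z)) = Re (poly p' z)" if z: "z \<in> sphere 0 r" for z
  proof -
    have zz: "z * cnj z = of_real (r\<^sup>2)" using z by (simp add: complex_norm_square[symmetric])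
    have "poly (pCons a p1) z * cnj (poly p2 z) =
       a * cnj b + cnj (cnj a * (z * poly q z)) + cnj b * (z * poly p1 z)
       + (z * cnj z) * (poly p1 z * cnj (poly q z))"
      by (simp add: p2 algebra_simps)
    also have "Re \<dots> = Re (a * cnj b) + Re (cnj a * (z * poly q z)) + Re (cnj b * (z * poly p1 z))
       + r\<^sup>2 * Re (poly p1 z * cnj (poly q z))"
      unfolding zz by (simp add: algebra_simps)
    also have "\<dots> = Re (poly p' z)"
      unfolding p[OF z] by (simp add: p'_def algebra_simps)
    finally show ?thesis .
  qed
  then show ?case by blast
qed

lemma real_polynomial_is_Re_poly_on_circle:
  fixes g :: "complex \<Rightarrow> real"
  assumes "real_polynomial_function g"
  shows "\<exists>p. \<forall>z \<in> sphere 0 r. g z = Re (poly p z)"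
  using assms
proof induction
  case (linear f)
  interpret bounded_linear f by fact
  have "f z = Re (poly [:0, Complex (f 1) (- f \<i>):] z)" for z
  proof -
    have "f z = f (Re z *\<^sub>R 1 + Im z *\<^sub>R \<i>)"
      by (rule arg_cong[of _ _ f]) (simp add: complex_eq_iff)
    also have "\<dots> = Re z * f 1 + Im z * f \<i>" by (simp only: add scaleR real_scaleR_def)
    finally show ?thesis by simp
  qed
  then show ?case by blast
next
  case (const c)
  show ?case by (rule exI[of _ "[:of_real c:]"]) simp
next
  case (add f g)
  then obtain p q where "\<forall>z\<in>sphere 0 r. f z = Re (poly p z)" "\<forall>z\<in>sphere 0 r. g z = Re (poly q z)"
    by blast
  then show ?case by (intro exI[of _ "p + q"]) simp
next
  case (mult f g)
  then obtain p q where p: "\<forall>z\<in>sphere 0 r. f z = Re (poly p z)"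
    and q: "\<forall>z\<in>sphere 0 r. g z = Re (poly q z)"
    by blast
  obtain k where k: "\<forall>z\<in>sphere 0 r. Re (poly p z * cnj (poly q z)) = Re (poly k z)"
    using Re_poly_mult_cnj_on_circle by blast
  have prod: "Re a * Re b = (Re (a * b) + Re (a * cnj b)) / 2" for a b by simp
  show ?case
    by (rule exI[of _ "smult (1/2) (p * q + k)"])
       (use p q k in \<open>simp add: prod del: complex_cnj times_complex.sel\<close>)
qed

text \<open>
  A continuous function on the circle is approximated from above by boundary values of \<open>Re p\<close>, which is
  harmonic in the whole disc. This stands in for the solution of the Dirichlet problem: the majorant
  need only be good up to \<open>\<epsilon>\<close>.
\<close>
lemma harmonic_majorant_on_circle:
  fixes u :: "complex \<Rightarrow> real"
  assumes "continuous_on (sphere 0 r) u" "\<epsilon> > 0"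
  obtains p where "\<And>z. z \<in> sphere 0 r \<Longrightarrow> u z \<le> Re (poly p z) \<and> Re (poly p z) \<le> u z + \<epsilon>"
proof -
  \<comment> \<open>Approximating \<open>u + \<epsilon>/2\<close> to within \<open>\<epsilon>/2\<close> makes the error one-sided.\<close>
  have "continuous_on (sphere 0 r) (\<lambda>z. u z + \<epsilon> / 2)"
    by (intro continuous_intros assms)
  then obtain g where g: "real_polynomial_function g"
    "\<And>z. z \<in> sphere 0 r \<Longrightarrow> \<bar>u z + \<epsilon> / 2 - g z\<bar> < \<epsilon> / 2"
    using Stone_Weierstrass_real_polynomial_function[of "sphere 0 r" "\<lambda>z. u z + \<epsilon> / 2" "\<epsilon> / 2"] assms(2)
    by auto
  obtain p where p: "\<forall>z \<in> sphere 0 r. g z = Re (poly p z)"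
    using real_polynomial_is_Re_poly_on_circle[OF g(1)] by blast
  show thesis
  proof (rule that[of p])
    fix z :: complex assume "z \<in> sphere 0 r"
    then show "u z \<le> Re (poly p z) \<and> Re (poly p z) \<le> u z + \<epsilon>"
      using g(2)[of z] bspec[OF p, of z] unfolding abs_less_iff by auto
  qed
qed

text \<open>
  The function \<open>v = ln (max \<bar>h\<bar> \<bar>k\<bar>)\<close> is subharmonic, so its means over circles increase. Concretely, let
  \<open>Re p\<close> lie between \<open>v\<close> and \<open>v + \<epsilon>\<close> on the outer circle. There \<open>h * exp (- p)\<close> and \<open>k * exp (- p)\<close> have
  modulus at most \<open>1\<close>; by the maximum modulus principle the same holds inside, that is,
  \<open>v \<le> Re p\<close> in the disc. The means of \<open>Re p\<close> over both circles equal \<open>Re (p 0)\<close>.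
\<close>
lemma circle_mean_ln_max_norm_mono:
  assumes hol: "h holomorphic_on ball 0 R" "k holomorphic_on ball 0 R"
    and cont: "continuous_on (cball 0 R) h" "continuous_on (cball 0 R) k"
    and nz: "\<And>z. z \<in> cball 0 R \<Longrightarrow> h z \<noteq> 0 \<or> k z \<noteq> 0"
    and r: "0 < r" "r \<le> R"
  shows "circle_mean (\<lambda>z. ln (max (norm (h z)) (norm (k z)))) r
       \<le> circle_mean (\<lambda>z. ln (max (norm (h z)) (norm (k z)))) R"
proof (rule field_le_epsilon)
  fix \<epsilon> :: real assume "\<epsilon> > 0"
  define v where "v z = ln (max (norm (h z)) (norm (k z)))" for z
  have pos: "max (norm (h z)) (norm (k z)) > 0" if "z \<in> cball 0 R" for z
    using nz[OF that] by (auto simp: less_max_iff_disj)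
  have v_cont: "continuous_on (cball 0 R) v"
    unfolding v_def by (intro continuous_intros cont) (use pos in force)
  have v_int: "circle_integrable v t" if "0 < t" "t \<le> R" for t
    using that by (intro continuous_imp_circle_integrable continuous_on_subset[OF v_cont]) auto
  obtain p where p: "\<And>z. z \<in> sphere 0 R \<Longrightarrow> v z \<le> Re (poly p z) \<and> Re (poly p z) \<le> v z + \<epsilon>"
    using harmonic_majorant_on_circle[OF continuous_on_subset[OF v_cont sphere_cball] \<open>\<epsilon> > 0\<close>] by blast
  have p_int: "circle_integrable (\<lambda>z. Re (poly p z)) t" if "0 < t" for t
    using that by (intro continuous_imp_circle_integrable continuous_intros) auto
  have p_mean: "circle_mean (\<lambda>z. Re (poly p z)) t = Re (poly p 0)" if "0 < t" for t
    using that by (intro holomorphic_mean_value holomorphic_intros)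
  have bound: "norm (g z * exp (- poly p z)) \<le> 1"
    if g: "g holomorphic_on ball 0 R" "continuous_on (cball 0 R) g"
      "\<And>z. norm (g z) \<le> max (norm (h z)) (norm (k z))" and z: "z \<in> cball 0 R" for g z
  proof (rule maximum_modulus_frontier[of "\<lambda>z. g z * exp (- poly p z)" "cball 0 R"])
    show "(\<lambda>z. g z * exp (- poly p z)) holomorphic_on interior (cball 0 R)"
      using g by (auto intro!: holomorphic_intros)
    show "continuous_on (closure (cball 0 R)) (\<lambda>z. g z * exp (- poly p z))"
      using g by (auto intro!: continuous_intros)
    fix z :: complex assume "z \<in> frontier (cball 0 R)"
    then have z: "z \<in> sphere 0 R" using r by simp
    have "norm (g z) \<le> exp (v z)"
      using g(3)[of z] pos[of z] z by (simp add: v_def)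
    also have "\<dots> \<le> exp (Re (poly p z))" using p[OF z] by simp
    finally show "norm (g z * exp (- poly p z)) \<le> 1"
      by (simp add: norm_mult norm_divide exp_minus field_simps)
  qed (use z in auto)
  have v_le: "v z \<le> Re (poly p z)" if "z \<in> cball 0 R" for z
  proof -
    have "max (norm (h z)) (norm (k z)) \<le> exp (Re (poly p z))"
      using bound[OF hol(1) cont(1) _ that] bound[OF hol(2) cont(2) _ that]
      by (simp add: norm_mult norm_divide exp_minus field_simps)
    then have "v z \<le> ln (exp (Re (poly p z)))"
      unfolding v_def using pos[OF that] by (intro ln_mono)
    then show ?thesis by simp
  qed
  have "circle_mean v r \<le> circle_mean (\<lambda>z. Re (poly p z)) r"
    using r v_le by (intro circle_mean_mono v_int p_int) auto
  also have "\<dots> = circle_mean (\<lambda>z. Re (poly p z)) R"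
    using r by (simp add: p_mean)
  also have "\<dots> \<le> circle_mean (\<lambda>z. v z + \<epsilon>) R"
    using r p v_int[of R]
    by (intro circle_mean_mono p_int circle_integrable_add) auto
  also have "\<dots> = circle_mean v R + \<epsilon>"
    using r v_int[of R]
    by (subst circle_mean_add) auto
  finally show "circle_mean (\<lambda>z. ln (max (norm (h z)) (norm (k z)))) r
       \<le> circle_mean (\<lambda>z. ln (max (norm (h z)) (norm (k z)))) R + \<epsilon>"
    by (simp add: v_def[abs_def])
qed

section \<open>Jensen's formula for linear factors\<close>

text \<open>
  For \<open>norm c < x\<close> the function \<open>x - c z\<close> maps the closed unit disc into the right half-plane, where \<open>Ln\<close>
  is holomorphic; the claim is the mean value property of its real part.
\<close>
lemma circle_mean_ln_norm_linear_strict: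
  assumes "norm c < x"
  shows "circle_integrable (\<lambda>z. ln (norm (of_real x - c * z))) 1"
    and "circle_mean (\<lambda>z. ln (norm (of_real x - c * z))) 1 = ln x"
proof -
  have x: "x > 0" using assms norm_ge_zero[of c] by linarith
  have small: "norm (c * z) < x" if "z \<in> cball 0 1" for z
    using assms that mult_left_le[of "norm z" "norm c"] by (simp add: norm_mult)
  have Re_pos: "Re (of_real x - c * z) > 0" if "z \<in> cball 0 1" for z
    using small[OF that] complex_Re_le_cmod[of "c * z"] by simp
  have nz: "of_real x - c * z \<noteq> 0" if "z \<in> cball 0 1" for z
    using Re_pos[OF that] by force
  have ln_eq: "ln (norm (of_real x - c * z)) = Re (Ln (of_real x - c * z))" if "z \<in> cball 0 1" for z
    using nz[OF that] by simp
  show "circle_integrable (\<lambda>z. ln (norm (of_real x - c * z))) 1"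
    by (intro continuous_imp_circle_integrable continuous_intros) (use nz in auto)
  have "circle_mean (\<lambda>z. ln (norm (of_real x - c * z))) 1
      = circle_mean (\<lambda>z. Re (Ln (of_real x - c * z))) 1"
    by (rule circle_mean_cong_countable[of "{}"]) (use ln_eq in auto)
  also have "\<dots> = Re (Ln (of_real x - c * 0))"
  proof (rule holomorphic_mean_value)
    have "of_real x - c * z \<notin> \<real>\<^sub>\<le>\<^sub>0" if "z \<in> cball 0 1" for z
      using Re_pos[OF that] unfolding complex_nonpos_Reals_iff by linarith
    then show "(\<lambda>z. Ln (of_real x - c * z)) holomorphic_on cball 0 1"
      by (auto intro!: holomorphic_intros)
  qed simp
  also have "\<dots> = ln x" using x by (simp add: Ln_of_real)
  finally show "circle_mean (\<lambda>z. ln (norm (of_real x - c * z))) 1 = ln x" .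
qed

lemma norm_of_real_diff_mono:
  assumes "norm (u::complex) \<le> x" "x \<le> y"
  shows "norm (of_real x - u) \<le> norm (of_real y - u)"
proof -
  have "Re u \<le> x" using complex_Re_le_cmod[of u] assms by linarith
  then have "(x - Re u)\<^sup>2 \<le> (y - Re u)\<^sup>2" using assms by (intro power_mono) auto
  then show ?thesis by (simp add: cmod_def)
qed

text \<open>
  In the new case \<open>norm c = x\<close> the integrand has a logarithmic singularity on the circle. Letting
  \<open>x\<close> be approached from above, \<open>norm (x - c z)\<close> decreases pointwise, so monotone convergence gives both
  integrability and the value of the integral.
\<close>
lemma circle_mean_ln_norm_linear:
  assumes "norm c \<le> x" "x > 0"
  shows "circle_integrable (\<lambda>z. ln (norm (of_real x - c * z))) 1"
    and "circle_mean (\<lambda>z. ln (norm (of_real x - c * z))) 1 = ln x"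
proof -
  define X where "X n = x + 1 / real (Suc n)" for n
  have X_gt: "norm c < X n" for n
  proof -
    have "0 < 1 / real (Suc n)" by simp
    then show ?thesis unfolding X_def using assms(1) by linarith
  qed
  have X_lim: "X \<longlonglongrightarrow> x"
    unfolding X_def[abs_def] using tendsto_add[OF tendsto_const LIMSEQ_inverse_real_of_nat, of x]
    by (simp add: inverse_eq_divide)
  have X_anti: "X n \<le> X m" if "m \<le> n" for m n
    unfolding X_def using that by (simp add: frac_le)
  have X_pos: "X n > 0" for n using X_gt[of n] norm_ge_zero[of c] by linarith
  define F where "F n \<theta> = indicator {0..2 * pi} \<theta> *\<^sub>R (- ln (norm (of_real (X n) - c * cis \<theta>)))" for n \<theta>
  define G where "G \<theta> = indicator {0..2 * pi} \<theta> *\<^sub>R (- ln (norm (of_real x - c * cis \<theta>)))" for \<theta>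
  have F_int: "integrable lborel (F n)" for n
    using circle_mean_ln_norm_linear_strict(1)[OF X_gt, of n]
    unfolding F_def circle_integrable_def set_integrable_def by simp
  have F_lint: "integral\<^sup>L lborel (F n) = - (2 * pi) * ln (X n)" for n
    using circle_mean_ln_norm_linear_strict(2)[OF X_gt, of n]
    by (simp add: F_def[abs_def] circle_mean_def set_lebesgue_integral_def field_simps)
  have nz: "of_real (X n) - c * cis \<theta> \<noteq> 0" for n \<theta>
  proof
    assume "of_real (X n) - c * cis \<theta> = 0"
    then have "norm (of_real (X n) :: complex) = norm (c * cis \<theta>)" by simp
    then show False using X_gt[of n] X_pos[of n] by (simp add: norm_mult)
  qed
  have F_mono: "mono (\<lambda>n. F n \<theta>)" for \<theta>
  proof (rule monoI)
    fix m n :: nat assume "m \<le> n"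
    then have "norm (of_real (X n) - c * cis \<theta>) \<le> norm (of_real (X m) - c * cis \<theta>)"
      using X_gt[of n] by (intro norm_of_real_diff_mono X_anti) (auto simp: norm_mult)
    then show "F m \<theta> \<le> F n \<theta>"
      using nz by (auto simp: F_def indicator_def)
  qed
  have "countable {\<theta>. of_real 1 * cis \<theta> \<in> {z. c * z = of_real x}}"
  proof (rule countable_circle_preimage)
    have "{z. c * z = of_real x} \<subseteq> {of_real x / c}" using assms by (cases "c = 0") (auto simp: field_simps)
    then show "countable {z. c * z = of_real x}" by (rule countable_subset) auto
  qed simp
  then have "AE \<theta> in lborel. \<theta> \<notin> {\<theta>. of_real 1 * cis \<theta> \<in> {z. c * z = of_real x}}"
    by (intro AE_not_in countable_imp_null_set_lborel)
  then have F_lim: "AE \<theta> in lborel. (\<lambda>n. F n \<theta>) \<longlonglongrightarrow> G \<theta>"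
  proof eventually_elim
    case (elim \<theta>)
    then have "norm (of_real x - c * cis \<theta>) \<noteq> 0" by simp
    then show ?case unfolding F_def G_def by (intro tendsto_intros X_lim)
  qed
  have lint_lim: "(\<lambda>n. integral\<^sup>L lborel (F n)) \<longlonglongrightarrow> - (2 * pi) * ln x"
    unfolding F_lint using assms by (intro tendsto_intros X_lim) auto
  have [measurable]: "cis \<in> borel_measurable borel"
    by (intro borel_measurable_continuous_onI continuous_intros)
  have G_meas: "G \<in> borel_measurable lborel" unfolding G_def by measurable
  have G_int: "integrable lborel G" and G_lint: "integral\<^sup>L lborel G = - (2 * pi) * ln x"
    using integrable_monotone_convergence[OF F_int AE_I2[OF F_mono] F_lim lint_lim G_meas]
      integral_monotone_convergence[OF F_int AE_I2[OF F_mono] F_lim lint_lim G_meas] by auto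
  have G_eq: "indicator {0..2 * pi} \<theta> *\<^sub>R ln (norm (of_real x - c * (of_real 1 * cis \<theta>))) = - G \<theta>" for \<theta>
    by (simp add: G_def)
  show "circle_integrable (\<lambda>z. ln (norm (of_real x - c * z))) 1"
    unfolding circle_integrable_def set_integrable_def G_eq using G_int by simp
  show "circle_mean (\<lambda>z. ln (norm (of_real x - c * z))) 1 = ln x"
    unfolding circle_mean_def set_lebesgue_integral_def G_eq using G_lint by simp
qed

text \<open>
  Jensen's formula for a single zero. Multiplying \<open>z - b\<close> by a unimodular factor, and conjugating it if
  \<open>b\<close> lies in the disc, turns it into the form \<open>x - c * cis \<theta>\<close> with \<open>x = max r \<bar>b\<bar>\<close>.
\<close>
lemma circle_mean_ln_norm_diff:
  assumes "r > 0"
  shows "circle_integrable (\<lambda>z. ln (norm (z - b))) r"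
    and "circle_mean (\<lambda>z. ln (norm (z - b))) r = ln (max r (norm b))"
proof -
  define x where "x = max r (norm b)"
  define c where "c = (if norm b \<le> r then cnj b else of_real r * cnj (sgn b))"
  have c: "norm c \<le> x" "x > 0"
    using assms by (auto simp: x_def c_def norm_mult norm_sgn)
  have eq: "norm (of_real r * cis \<theta> - b) = norm (of_real x - c * (of_real 1 * cis \<theta>))" for \<theta>
  proof (cases "norm b \<le> r")
    case True
    have "of_real x - c * (of_real 1 * cis \<theta>) = cis \<theta> * cnj (of_real r * cis \<theta> - b)"
      using True by (simp add: x_def c_def cis_cnj algebra_simps cis_mult flip: cis_inverse)
    then have "norm (of_real x - c * (of_real 1 * cis \<theta>)) = norm (cnj (of_real r * cis \<theta> - b))"
      by (simp only: norm_mult norm_cis mult_1)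
    then show ?thesis by (simp only: complex_mod_cnj)
  next
    case False
    then have b: "b \<noteq> 0" using assms by auto
    have "of_real (norm b) = b * cnj (sgn b)"
      using b by (simp add: sgn_eq complex_norm_square[symmetric] power2_eq_square)
    then have "of_real x - c * (of_real 1 * cis \<theta>) = - cnj (sgn b) * (of_real r * cis \<theta> - b)"
      using False by (simp add: x_def c_def algebra_simps)
    then show ?thesis using b by (simp add: norm_mult norm_sgn)
  qed
  show "circle_integrable (\<lambda>z. ln (norm (z - b))) r"
    using circle_mean_ln_norm_linear(1)[OF c] unfolding circle_integrable_def eq .
  show "circle_mean (\<lambda>z. ln (norm (z - b))) r = ln (max r (norm b))"
    using circle_mean_ln_norm_linear(2)[OF c] unfolding circle_mean_def eq x_def[symmetric] .
qed

section \<open>Meromorphic functions as quotients on a disc\<close>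

abbreviation pole_mult :: "(complex \<Rightarrow> complex) \<Rightarrow> complex \<Rightarrow> nat" where
  "pole_mult f b \<equiv> nat (- zorder f b)"

lemma finite_singularities_cball:
  assumes "f meromorphic_on UNIV"
  shows "finite {z. norm z \<le> R \<and> \<not> f analytic_on {z}}"
proof -
  have "finite (cball 0 R \<inter> {z. \<not> f analytic_on {z}})"
    using sparse_in_subset[OF meromorphic_on_imp_sparse_singularities[OF assms] subset_UNIV]
    by (intro sparse_in_compact_finite compact_cball)
  then show ?thesis by (rule finite_subset[rotated]) auto
qed

lemma finite_poles_cball:
  assumes "f meromorphic_on UNIV"
  shows "finite {z. norm z \<le> R \<and> is_pole f z}"
  by (rule finite_subset[OF _ finite_singularities_cball[OF assms, of R]])
     (auto dest: analytic_at_imp_no_pole)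

text \<open>
  The point of a limit different from \<open>0\<close> is that \<open>pole_mult f b\<close> is the exact order: after multiplication
  by the denominator no common zero of numerator and denominator remains.
\<close>
lemma pole_cancelled_limit:
  assumes "f meromorphic_on UNIV" "is_pole f b"
  obtains c where "c \<noteq> 0" "(\<lambda>z. f z * (z - b) ^ pole_mult f b) \<midarrow>b\<rightarrow> c"
proof -
  have "isolated_singularity_at f b"
    using assms(1) by (auto simp: meromorphic_on_altdef)
  then obtain S where S: "f holomorphic_on S - {b}" "open S" "b \<in> S"
    using analytic_imp_holomorphic unfolding isolated_singularity_at_iff_analytic_nhd by blast
  obtain \<delta> where "zor_poly f b b \<noteq> 0" "\<delta> > 0" and hol: "zor_poly f b holomorphic_on cball b \<delta>"
    and eq: "\<And>w. w \<in> cball b \<delta> - {b} \<Longrightarrow> f w = zor_poly f b w / (w - b) ^ pole_mult f b"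
    using zorder_exist_pole[OF S assms(2)] by blast
  have "isCont (zor_poly f b) b"
    using \<open>\<delta> > 0\<close> by (intro continuous_on_interior[OF holomorphic_on_imp_continuous_on[OF hol]]) simp
  then have "zor_poly f b \<midarrow>b\<rightarrow> zor_poly f b b" by (simp add: isCont_def)
  moreover have "eventually (\<lambda>w. w \<in> ball b \<delta> - {b}) (at b)"
    using \<open>\<delta> > 0\<close> by (intro eventually_at_in_open) auto
  then have "eventually (\<lambda>w. zor_poly f b w = f w * (w - b) ^ pole_mult f b) (at b)"
  proof eventually_elim
    case (elim w)
    then have w: "w \<in> cball b \<delta> - {b}" "(w - b) ^ pole_mult f b \<noteq> 0" by auto
    show ?case using eq[OF w(1)] unfolding nonzero_eq_divide_eq[OF w(2)] by (rule sym)
  qed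
  ultimately have "(\<lambda>z. f z * (z - b) ^ pole_mult f b) \<midarrow>b\<rightarrow> zor_poly f b b"
    by (rule Lim_transform_eventually)
  with \<open>zor_poly f b b \<noteq> 0\<close> show thesis by (rule that)
qed

text \<open>
  In a disc, \<open>f\<close> is a quotient \<open>h / P\<close> of analytic functions without common zeros, where \<open>P\<close> is the
  polynomial formed from the poles. The absence of common zeros makes
  \<open>ln (max \<bar>h\<bar> \<bar>P\<bar>)\<close> a finite continuous function.
\<close>
lemma meromorphic_quotient_on_cball:
  fixes f :: "complex \<Rightarrow> complex" and R :: real
  assumes f: "f meromorphic_on UNIV"
  defines "P \<equiv> (\<lambda>z. \<Prod>b | norm b \<le> R \<and> is_pole f b. (z - b) ^ pole_mult f b)"
  obtains h where "h analytic_on cball 0 R"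
    and "\<And>z. z \<in> cball 0 R \<Longrightarrow> h z \<noteq> 0 \<or> P z \<noteq> 0"
    and "\<And>z. f analytic_on {z} \<Longrightarrow> h z = f z * P z"
proof -
  define B where "B = {b. norm b \<le> R \<and> is_pole f b}"
  have fin: "finite B" unfolding B_def by (rule finite_poles_cball[OF f])
  have P_eq: "P z = (\<Prod>b\<in>B. (z - b) ^ pole_mult f b)" for z by (simp add: P_def B_def)
  have P_ana: "P analytic_on A" for A unfolding P_def by (intro analytic_intros)
  define h where "h = remove_sings (\<lambda>z. f z * P z)"
  have "(\<lambda>z. f z * P z) meromorphic_on UNIV"
    by (intro meromorphic_intros f analytic_on_imp_meromorphic_on P_ana)
  then have iso: "isolated_singularity_at (\<lambda>z. f z * P z) z" for z
    by (auto simp: meromorphic_on_altdef)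
  have P_lim: "P \<midarrow>z\<rightarrow> P z" for z
    using analytic_at_imp_isCont[OF P_ana] by (simp add: isCont_def)
  have at_pole: "\<exists>c. c \<noteq> 0 \<and> (\<lambda>z. f z * P z) \<midarrow>b\<rightarrow> c" if "b \<in> B" for b
  proof -
    obtain c where c: "c \<noteq> 0" "(\<lambda>z. f z * (z - b) ^ pole_mult f b) \<midarrow>b\<rightarrow> c"
      using pole_cancelled_limit[OF f] \<open>b \<in> B\<close> unfolding B_def by blast
    define Q where "Q z = (\<Prod>b'\<in>B - {b}. (z - b') ^ pole_mult f b')" for z
    have "(\<lambda>z. (f z * (z - b) ^ pole_mult f b) * Q z) \<midarrow>b\<rightarrow> c * Q b"
      unfolding Q_def by (intro tendsto_intros c)
    moreover have "P z = (z - b) ^ pole_mult f b * Q z" for z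
      using fin that by (simp add: P_eq Q_def prod.remove)
    ultimately have "(\<lambda>z. f z * P z) \<midarrow>b\<rightarrow> c * Q b" by (simp add: mult.assoc)
    moreover have "Q b \<noteq> 0" using fin by (auto simp: Q_def)
    ultimately show ?thesis using c(1) by (intro exI[of _ "c * Q b"]) auto
  qed
  have no_pole: "\<exists>c. (\<lambda>z. f z * P z) \<midarrow>z\<rightarrow> c" if "z \<in> cball 0 R" "z \<notin> B" for z
  proof -
    have "not_essential f z" using f by (auto simp: meromorphic_on_altdef)
    moreover have "\<not> is_pole f z" using that by (simp add: B_def)
    ultimately obtain c where "f \<midarrow>z\<rightarrow> c" unfolding not_essential_def by blast
    then show ?thesis using tendsto_mult[OF _ P_lim] by blast
  qed
  show thesis
  proof (rule that)
    have "h analytic_on {z}" if z: "z \<in> cball 0 R" for z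
    proof -
      obtain c where "(\<lambda>z. f z * P z) \<midarrow>z\<rightarrow> c"
        using at_pole[of z] no_pole[OF z] by blast
      then show ?thesis unfolding h_def by (rule remove_sings_analytic_at[OF iso])
    qed
    then show "h analytic_on cball 0 R" using analytic_on_analytic_at by blast
  next
    fix z :: complex assume "z \<in> cball 0 R"
    show "h z \<noteq> 0 \<or> P z \<noteq> 0"
    proof (cases "z \<in> B")
      case True
      then obtain c where "c \<noteq> 0" "(\<lambda>z. f z * P z) \<midarrow>z\<rightarrow> c" using at_pole by blast
      then have "h z \<noteq> 0" unfolding h_def by (simp only: remove_sings_eqI not_False_eq_True)
      then show ?thesis ..
    next
      case False
      then show ?thesis using fin by (auto simp: P_eq)
    qed
  next
    fix z assume "f analytic_on {z}"
    then have "(\<lambda>z. f z * P z) analytic_on {z}" by (intro analytic_intros P_ana)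
    then show "h z = f z * P z" unfolding h_def by simp
  qed
qed

section \<open>The counting function of poles\<close>

lemma step_over_t_integral:
  fixes \<beta> r :: real
  assumes "\<beta> > 0"
  shows "set_integrable lborel {0..r} (\<lambda>t. of_bool (\<beta> \<le> t) / t)"
    and "(LINT t:{0..r}|lborel. of_bool (\<beta> \<le> t) / t) = ln (max r \<beta>) - ln \<beta>"
proof -
  have eq: "indicator {0..r} t *\<^sub>R (of_bool (\<beta> \<le> t) / t) = indicator {\<beta>..r} t *\<^sub>R (1 / t)" for t
    using assms by (auto simp: indicator_def)
  have "continuous_on {\<beta>..r} (\<lambda>t. 1 / t)"
    using assms by (intro continuous_intros) auto
  then show "set_integrable lborel {0..r} (\<lambda>t. of_bool (\<beta> \<le> t) / t)"
    unfolding set_integrable_def eq by (intro borel_integrable_compact) auto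
  show "(LINT t:{0..r}|lborel. of_bool (\<beta> \<le> t) / t) = ln (max r \<beta>) - ln \<beta>"
  proof (cases "\<beta> \<le> r")
    case True
    have "(\<integral>t. 1 / t * indicator {\<beta>..r} t \<partial>lborel) = ln r - ln \<beta>"
      using assms True
      by (intro integral_FTC_Icc_real DERIV_ln_divide isCont_divide continuous_const continuous_ident) auto
    then show ?thesis
      unfolding set_lebesgue_integral_def eq using True by (simp add: mult.commute max_def)
  next
    case False
    then show ?thesis
      unfolding set_lebesgue_integral_def eq by (simp add: max_def)
  qed
qed

text \<open>
  A pole \<open>b \<noteq> 0\<close> contributes \<open>ln (r / \<bar>b\<bar>)\<close> if \<open>\<bar>b\<bar> \<le> r\<close> and nothing otherwise, which is
  \<open>ln (max r \<bar>b\<bar>) - ln \<bar>b\<bar>\<close> in both cases. A pole at the origin contributes \<open>ln r\<close>; since \<open>ln 0 = 0\<close>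
  by convention, the same expression covers it.
\<close>
lemma pole_counting_eq:
  fixes f :: "complex \<Rightarrow> complex"
  assumes f: "f meromorphic_on UNIV" and r: "0 < r" "r \<le> R"
  shows "pole_counting r f =
    (\<Sum>b | norm b \<le> R \<and> is_pole f b. real (pole_mult f b) * (ln (max r (norm b)) - ln (norm b)))"
proof -
  define B where "B = {b. norm b \<le> R \<and> is_pole f b}"
  have fin: "finite B" unfolding B_def by (rule finite_poles_cball[OF f])
  have count: "real (pole_count t f) = (\<Sum>b\<in>B. real (pole_mult f b) * of_bool (norm b \<le> t))"
    if "t \<le> R" for t
  proof -
    have "{z. norm z \<le> t \<and> is_pole f z} = {b\<in>B. norm b \<le> t}" using that by (auto simp: B_def)
    then show ?thesis
      by (simp add: pole_count_def sum.inter_filter[OF fin] of_bool_def if_distrib cong: if_cong)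
  qed
  have diff: "(real (pole_count t f) - real (pole_count 0 f)) / t
      = (\<Sum>b\<in>B - {0}. real (pole_mult f b) * (of_bool (norm b \<le> t) / t))" if "0 \<le> t" "t \<le> R" for t
  proof -
    have "real (pole_count t f) - real (pole_count 0 f)
        = (\<Sum>b\<in>B. real (pole_mult f b) * (of_bool (norm b \<le> t) - of_bool (b = 0)))"
      using that by (simp add: count sum_subtractf right_diff_distrib)
    also have "\<dots> = (\<Sum>b\<in>B - {0}. real (pole_mult f b) * (of_bool (norm b \<le> t) - of_bool (b = 0)))"
      using fin that by (intro sum.mono_neutral_right) auto
    also have "\<dots> = (\<Sum>b\<in>B - {0}. real (pole_mult f b) * of_bool (norm b \<le> t))"
      by (intro sum.cong) auto
    finally show ?thesis by (simp add: sum_divide_distrib)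
  qed
  have "(LINT t:{0..r}|lborel. (real (pole_count t f) - real (pole_count 0 f)) / t)
      = (LINT t:{0..r}|lborel. (\<Sum>b\<in>B - {0}. real (pole_mult f b) * (of_bool (norm b \<le> t) / t)))"
    using r diff by (intro set_lebesgue_integral_cong) auto
  also have "\<dots> = (\<Sum>b\<in>B - {0}. (LINT t:{0..r}|lborel. real (pole_mult f b) * (of_bool (norm b \<le> t) / t)))"
    unfolding set_lebesgue_integral_def scaleR_sum_right
    using set_integrable_mult_right[OF step_over_t_integral(1)]
    by (intro Bochner_Integration.integral_sum) (auto simp: set_integrable_def)
  also have "\<dots> = (\<Sum>b\<in>B - {0}. real (pole_mult f b) * (ln (max r (norm b)) - ln (norm b)))"
    by (intro sum.cong) (simp_all add: step_over_t_integral(2) del: times_divide_eq_right)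
  also have "\<dots> + real (pole_count 0 f) * ln r
     = (\<Sum>b\<in>B. real (pole_mult f b) * (ln (max r (norm b)) - ln (norm b)))"
  proof -
    have "real (pole_count 0 f) = (\<Sum>b\<in>B. real (pole_mult f b) * of_bool (b = 0))"
      using r by (simp add: count)
    also have "\<dots> = (if 0 \<in> B then real (pole_mult f 0) else 0)"
      using fin by (simp add: of_bool_def if_distrib sum.delta cong: if_cong)
    finally have "real (pole_count 0 f) = \<dots>" .
    then show ?thesis
      using r sum.remove[OF fin, of 0 "\<lambda>b. real (pole_mult f b) * (ln (max r (norm b)) - ln (norm b))"]
      by (cases "0 \<in> B") simp_all
  qed
  finally show ?thesis unfolding pole_counting_def B_def by simp
qed

section \<open>Monotonicity of the Nevanlinna characteristic\<close>

text \<open>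
  With \<open>p\<close> the denominator and \<open>w * p\<close> the numerator of a quotient, this writes \<open>log\<^sup>+\<close> as a
  difference of subharmonic functions.
\<close>
lemma log_plus_norm_quotient:
  fixes w p :: "'a :: real_normed_field"
  assumes "p \<noteq> 0"
  shows "log_plus (norm w) = ln (max (norm (w * p)) (norm p)) - ln (norm p)"
proof (cases "norm w \<le> 1")
  case True
  then have "norm (w * p) \<le> norm p" by (simp add: norm_mult mult_left_le_one_le)
  then show ?thesis using True by (simp add: log_plus_def max_def)
next
  case False
  then have "norm p \<le> norm (w * p)"
    using mult_right_mono[of 1 "norm w" "norm p"] by (simp add: norm_mult)
  moreover have "ln (norm (w * p)) = ln (norm w) + ln (norm p)"
    using False assms by (auto simp: norm_mult intro!: ln_mult_pos)
  ultimately show ?thesis using False by (simp add: log_plus_def max_def)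
qed

lemma ln_norm_prod_power:
  fixes z :: complex
  assumes "finite B" "z \<notin> B"
  shows "ln (norm (\<Prod>b\<in>B. (z - b) ^ m b)) = (\<Sum>b\<in>B. real (m b) * ln (norm (z - b)))"
proof -
  have "ln (\<Prod>b\<in>B. norm (z - b) ^ m b) = (\<Sum>b\<in>B. ln (norm (z - b) ^ m b))"
    using assms by (intro ln_prod) auto
  then show ?thesis using assms by (simp add: prod_norm[symmetric] norm_power ln_realpow)
qed

text \<open>
  Write \<open>f = h / P\<close> in the disc of radius \<open>R\<close>. Then \<open>log\<^sup>+ \<bar>f\<bar> = ln (max \<bar>h\<bar> \<bar>P\<bar>) - ln \<bar>P\<bar>\<close>, and Jensen's
  formula evaluates the mean of \<open>ln \<bar>P\<bar>\<close> as the sum of \<open>ln (max t \<bar>b\<bar>)\<close> over the poles \<open>b\<close>, counted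
  with multiplicity. The same terms
  occur with the opposite sign in the counting function, so up to the constant sum of \<open>ln \<bar>b\<bar>\<close> the
  characteristic is a circle mean of a subharmonic function, for all radii up to \<open>R\<close> at once.
\<close>
lemma nevanlinna_char_mono:
  assumes f: "f meromorphic_on UNIV" and r: "0 < r" "r \<le> R"
  shows "nevanlinna_char r f \<le> nevanlinna_char R f"
proof -
  define B where "B = {b. norm b \<le> R \<and> is_pole f b}"
  define m where "m b = pole_mult f b" for b
  define P where "P z = (\<Prod>b\<in>B. (z - b) ^ m b)" for z
  have fin: "finite B" unfolding B_def by (rule finite_poles_cball[OF f])
  obtain h where h: "h analytic_on cball 0 R" "\<And>z. z \<in> cball 0 R \<Longrightarrow> h z \<noteq> 0 \<or> P z \<noteq> 0"
    "\<And>z. f analytic_on {z} \<Longrightarrow> h z = f z * P z"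
    using meromorphic_quotient_on_cball[OF f, of R] unfolding P_def B_def m_def by blast
  define v where "v z = ln (max (norm (h z)) (norm (P z)))" for z
  have h_cont: "continuous_on (cball 0 R) h"
    using h(1) by (intro holomorphic_on_imp_continuous_on analytic_imp_holomorphic)
  have h_hol: "h holomorphic_on ball 0 R"
    using h(1) by (intro analytic_imp_holomorphic) (auto intro: analytic_on_subset)
  have P_cont: "continuous_on A P" for A unfolding P_def by (intro continuous_intros)
  have P_hol: "P holomorphic_on A" for A unfolding P_def by (intro holomorphic_intros)
  have v_cont: "continuous_on (cball 0 R) v"
  proof -
    have "max (norm (h z)) (norm (P z)) \<noteq> 0" if "z \<in> cball 0 R" for z
      using h(2)[OF that] by (auto simp: max_def)
    then show ?thesis unfolding v_def by (intro continuous_intros h_cont P_cont) blast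
  qed
  have char_eq: "nevanlinna_char t f = circle_mean v t - (\<Sum>b\<in>B. real (m b) * ln (norm b))"
    if t: "0 < t" "t \<le> R" for t
  proof -
    let ?S = "{z. norm z \<le> R \<and> \<not> f analytic_on {z}}"
    have v_int: "circle_integrable v t"
      using t by (intro continuous_imp_circle_integrable continuous_on_subset[OF v_cont]) auto
    note sum = circle_mean_weighted_sum[OF fin circle_mean_ln_norm_diff(1)[OF t(1)], of "\<lambda>b. real (m b)" "\<lambda>b. b"]
    have "proximity t f = circle_mean (\<lambda>z. log_plus (norm (f z))) t"
      by (simp add: proximity_def circle_mean_def)
    also have "\<dots> = circle_mean (\<lambda>z. v z - (\<Sum>b\<in>B. real (m b) * ln (norm (z - b)))) t"
    proof (rule circle_mean_cong_countable[where B = ?S])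
      fix z assume "z \<in> sphere 0 t - ?S"
      then have z: "f analytic_on {z}" using t by auto
      then have "z \<notin> B" by (auto simp: B_def dest: analytic_at_imp_no_pole)
      then have "P z \<noteq> 0" using fin by (auto simp: P_def)
      then show "log_plus (norm (f z)) = v z - (\<Sum>b\<in>B. real (m b) * ln (norm (z - b)))"
        using log_plus_norm_quotient[of "P z" "f z"] ln_norm_prod_power[OF fin \<open>z \<notin> B\<close>, of m]
        by (simp add: v_def h(3)[OF z] P_def)
    qed (use t finite_singularities_cball[OF f] in \<open>auto intro: countable_finite\<close>)
    also have "\<dots> = circle_mean v t - (\<Sum>b\<in>B. real (m b) * ln (max t (norm b)))"
      by (simp add: circle_mean_diff[OF v_int sum(1)] sum(2) circle_mean_ln_norm_diff(2)[OF t(1)])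
    finally show ?thesis
      unfolding nevanlinna_char_def pole_counting_eq[OF f t]
      by (simp add: B_def m_def right_diff_distrib sum_subtractf)
  qed
  have "circle_mean v r \<le> circle_mean v R"
    unfolding v_def[abs_def] by (rule circle_mean_ln_max_norm_mono[OF h_hol P_hol h_cont P_cont h(2) r])
  then show ?thesis using r by (simp add: char_eq)
qed

section \<open>The growth theorem\<close>

theorem theorem5:
  fixes s :: real
  assumes "s > 1"
  shows "(\<forall>(T :: real \<Rightarrow> real) (r0 :: real).
            continuous_on {r0..} T \<and> mono_on {r0..} T \<and> (\<forall>r \<ge> r0. T r \<ge> 1) \<longrightarrow>
            holds_outside_measure r0 (zeta_real s)
              (\<lambda>r. T (r + 1 / T r) < (T r powr (1 / s) + 1) powr s))
       \<and> (\<forall>(f :: complex \<Rightarrow> complex) (r0 :: real).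
            f meromorphic_on UNIV \<and> growth_order f = \<infinity> \<and> r0 > 0 \<and> nevanlinna_char r0 f \<ge> 1 \<longrightarrow>
            holds_outside_measure r0 (zeta_real s)
              (\<lambda>r. let R = r + 1 / nevanlinna_char r f in
                 log_plus (nevanlinna_char R f / (R - r) * (R / r))
                 \<le> 2 * log_plus (nevanlinna_char r f)
                   + ln ((1 + 1 / nevanlinna_char r f powr (1 / s)) powr s)
                   + ln (1 + 1 / (r * nevanlinna_char r f))))"
proof (intro conjI allI impI)
  fix T :: "real \<Rightarrow> real" and r0 :: real
  assume "continuous_on {r0..} T \<and> mono_on {r0..} T \<and> (\<forall>r \<ge> r0. T r \<ge> 1)"
  then show "holds_outside_measure r0 (zeta_real s)
      (\<lambda>r. T (r + 1 / T r) < (T r powr (1 / s) + 1) powr s)"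
    using assms by (intro growth_outside_small_set) auto
next
  fix f :: "complex \<Rightarrow> complex" and r0 :: real
  assume f: "f meromorphic_on UNIV \<and> growth_order f = \<infinity> \<and> r0 > 0 \<and> nevanlinna_char r0 f \<ge> 1"
  then have "mono_on {r0..} (\<lambda>r. nevanlinna_char r f)"
    by (intro mono_onI nevanlinna_char_mono) auto
  then show "holds_outside_measure r0 (zeta_real s)
      (\<lambda>r. let R = r + 1 / nevanlinna_char r f in
         log_plus (nevanlinna_char R f / (R - r) * (R / r))
         \<le> 2 * log_plus (nevanlinna_char r f)
           + ln ((1 + 1 / nevanlinna_char r f powr (1 / s)) powr s)
           + ln (1 + 1 / (r * nevanlinna_char r f)))"
    using nevanlinna_growth[OF assms, of r0 "\<lambda>r. nevanlinna_char r f"] f by blast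
qed

end
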